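(* Let $X$ be a Dedekind complete Banach lattice having a Fatou norm with constant $\mathfrak{f}$, and let $\varepsilon\ge 0$. Then for every positive $\varepsilon$-band preserving operator $T\in B(X)$ there exists an operator $S$ on $X$ with $0\le S\le T$ such that $S$ is band preserving and $\|T-S\|\le 4\mathfrak{f}\varepsilon$.
   Context: $B(X)$ denotes the space of bounded linear operators on $X$. A band in a Banach lattice $X$ is an (order) ideal $Y\subset X$ which contains $\bigvee_\alpha y_\alpha$ for every family $(y_\alpha)$ in $Y$ whose supremum exists in $X$. A linear operator $T:X\to X$ is band preserving (BP) if $T(Y)\subset Y$ for every band $Y\subset X$. A linear map $T:X\to X$ is $\varepsilon$-band preserving ($\varepsilon$-BP) if for every $x\in X$, $\sup\{\||Tx|\wedge y\| : y\ge 0,\ y\perp x\}\le\varepsilon\|x\|$. A Banach lattice $X$ has Fatou norm with constant $\mathfrak{f}$ if for any non-negative increasing net $(x_i)\subset X$ with $\sup_i\|x_i\|<\infty$ and such that $\bigvee_i x_i$ exists in $X$, one has $\|\bigvee_i x_i\|\le\mathfrak{f}\sup_i\|x_i\|$. *)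

theory Defs
  imports "HOL-Analysis.Bounded_Linear_Function" "HOL-Library.Lattice_Algebras" "HOL-Library.Lub_Glb"
begin

class banach_lattice = banach + ordered_real_vector + lattice_ab_group_add_abs +
  assumes norm_mono_abs: "\<bar>x\<bar> \<le> \<bar>y\<bar> \<Longrightarrow> norm x \<le> norm y"

definition lattice_disjoint :: "'a::banach_lattice \<Rightarrow> 'a \<Rightarrow> bool" where
  "lattice_disjoint x y \<longleftrightarrow> inf \<bar>x\<bar> \<bar>y\<bar> = 0"

definition order_ideal :: "'a::banach_lattice set \<Rightarrow> bool" where
  "order_ideal Y \<longleftrightarrow> subspace Y \<and> (\<forall>x y. y \<in> Y \<and> \<bar>x\<bar> \<le> \<bar>y\<bar> \<longrightarrow> x \<in> Y)"

definition band :: "'a::banach_lattice set \<Rightarrow> bool" where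
  "band Y \<longleftrightarrow> order_ideal Y \<and> (\<forall>A s. A \<subseteq> Y \<and> isLub UNIV A s \<longrightarrow> s \<in> Y)"

definition band_preserving :: "('a::banach_lattice \<Rightarrow> 'a) \<Rightarrow> bool" where
  "band_preserving T \<longleftrightarrow> linear T \<and> (\<forall>Y. band Y \<longrightarrow> T ` Y \<subseteq> Y)"

text \<open>The supremum below is over a nonempty set (\<open>y = 0\<close>) bounded above by \<open>norm (T x)\<close>.\<close>

definition eps_band_preserving :: "real \<Rightarrow> ('a::banach_lattice \<Rightarrow> 'a) \<Rightarrow> bool" where
  "eps_band_preserving \<epsilon> T \<longleftrightarrow> linear T \<and>
     (\<forall>x. (SUP y\<in>{y. 0 \<le> y \<and> lattice_disjoint y x}. norm (inf \<bar>T x\<bar> y)) \<le> \<epsilon> * norm x)"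

definition operator_le :: "('a::banach_lattice \<Rightarrow> 'a) \<Rightarrow> ('a \<Rightarrow> 'a) \<Rightarrow> bool" where
  "operator_le S T \<longleftrightarrow> (\<forall>x\<ge>0. S x \<le> T x)"

definition directed_index :: "'i set \<Rightarrow> ('i \<Rightarrow> 'i \<Rightarrow> bool) \<Rightarrow> bool" where
  "directed_index I le \<longleftrightarrow> I \<noteq> {} \<and> (\<forall>i\<in>I. le i i) \<and>
     (\<forall>i\<in>I. \<forall>j\<in>I. \<forall>k\<in>I. le i j \<and> le j k \<longrightarrow> le i k) \<and>
     (\<forall>i\<in>I. \<forall>j\<in>I. \<exists>k\<in>I. le i k \<and> le j k)"

definition increasing_net :: "'i set \<Rightarrow> ('i \<Rightarrow> 'i \<Rightarrow> bool) \<Rightarrow> ('i \<Rightarrow> 'a::order) \<Rightarrow> bool" where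
  "increasing_net I le x \<longleftrightarrow> directed_index I le \<and> (\<forall>i\<in>I. \<forall>j\<in>I. le i j \<longrightarrow> x i \<le> x j)"

text \<open>
  Index sets are taken inside \<^typ>\<open>'a\<close>, since a definition cannot quantify over types; this
  loses nothing, because an increasing net can be reindexed by its range, see \<open>fatou_normD\<close>.
  The condition \<open>0 \<le> f\<close> matters only for the zero space, where the inequality would
  otherwise hold for negative \<open>f\<close> as well.
\<close>

definition fatou_norm :: "'a::banach_lattice itself \<Rightarrow> real \<Rightarrow> bool" where
  "fatou_norm _ f \<longleftrightarrow> 0 \<le> f \<and>
     (\<forall>(I::'a set) le (x::'a \<Rightarrow> 'a) s.
        increasing_net I le x \<and> (\<forall>i\<in>I. 0 \<le> x i) \<and>
        bdd_above ((\<lambda>i. norm (x i)) ` I) \<and> isLub UNIV (x ` I) s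
        \<longrightarrow> norm s \<le> f * (SUP i\<in>I. norm (x i)))"

lemma fatou_normD:
  fixes x :: "'i \<Rightarrow> 'a::banach_lattice"
  assumes f: "fatou_norm TYPE('a) f"
    and inc: "increasing_net I le x" and pos: "\<And>i. i \<in> I \<Longrightarrow> 0 \<le> x i"
    and bdd: "bdd_above ((\<lambda>i. norm (x i)) ` I)" and lub: "isLub UNIV (x ` I) s"
  shows "norm s \<le> f * (SUP i\<in>I. norm (x i))"
proof -
  have "increasing_net (x ` I) (\<le>) (\<lambda>a. a)"
    unfolding increasing_net_def directed_index_def
  proof (intro conjI ballI impI)
    show "x ` I \<noteq> {}"
      using inc by (auto simp: increasing_net_def directed_index_def)
  next
    fix a b assume "a \<in> x ` I" "b \<in> x ` I"
    then obtain i j where ij: "i \<in> I" "j \<in> I" "a = x i" "b = x j"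
      by blast
    then obtain k where "k \<in> I" "le i k" "le j k"
      using inc unfolding increasing_net_def directed_index_def by blast
    then show "\<exists>c\<in>x ` I. a \<le> c \<and> b \<le> c"
      using inc ij unfolding increasing_net_def by blast
  qed auto
  moreover have "bdd_above (norm ` (x ` I))"
    using bdd by (simp add: image_image)
  moreover have "\<forall>a\<in>x ` I. 0 \<le> a"
    using pos by auto
  moreover have "isLub UNIV ((\<lambda>a. a) ` x ` I) s"
    using lub by simp
  ultimately have "norm s \<le> f * (SUP a\<in>x ` I. norm a)"
    using f unfolding fatou_norm_def by blast
  then show ?thesis
    by (simp add: image_image)
qed

end

theory Submission
  imports Defs
begin

text \<open>
  Band projections \<open>P\<close> commute, and compressing \<open>T\<close> to \<open>P T P + (1 - P) T (1 - P)\<close> decreases a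
  positive operator. Hence the operators obtained from \<open>T\<close> by finitely many such compressions form
  a decreasing net, and \<open>S\<close> is its infimum. With \<open>U = 2 P - 1\<close> the compression equals
  \<open>(T + U T U) / 2\<close>, so each member of the net is a convex combination of operators \<open>U T U\<close>, where
  \<open>U = 2 R - 1\<close> for a band projection \<open>R\<close>. As \<open>T - U T U = 2 (R T (1 - R) + (1 - R) T R)\<close> and both
  summands have norm at most \<open>\<epsilon>\<close>, the whole net stays within distance \<open>4 \<epsilon>\<close> of \<open>T\<close>, and the
  Fatou property passes this on to \<open>S\<close> at the cost of the factor \<open>f\<close>.
\<close>

section \<open>Linear operators built from their values on the positive cone\<close>

lemma linear_extension_of_cone_map:
  fixes g :: "'a::banach_lattice \<Rightarrow> 'a"
  assumes add: "\<And>x y. 0 \<le> x \<Longrightarrow> 0 \<le> y \<Longrightarrow> g (x + y) = g x + g y"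
    and scale: "\<And>c x. 0 < c \<Longrightarrow> 0 \<le> x \<Longrightarrow> g (c *\<^sub>R x) = c *\<^sub>R g x"
  obtains G where "linear G" "\<And>x. 0 \<le> x \<Longrightarrow> G x = g x"
proof -
  \<comment> \<open>\<open>nprt x\<close> is nonpositive, so \<open>x = pprt x - (- nprt x)\<close>
    writes \<open>x\<close> as a difference of two elements of the cone.\<close>
  define G where "G x = g (pprt x) - g (- nprt x)" for x
  have g0: "g 0 = 0"
    using add[of 0 0] by simp
  \<comment> \<open>The value does not depend on the decomposition chosen. Linearity then follows by
    adding and scaling arbitrary decompositions.\<close>
  have G_diff: "G (a - b) = g a - g b" if "0 \<le> a" "0 \<le> b" for a b
  proof -
    let ?x = "a - b"
    have "pprt ?x + b = a + (- nprt ?x)"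
      using prts[of ?x] by (simp add: algebra_simps)
    then have "g (pprt ?x) + g b = g a + g (- nprt ?x)"
      using add that by (metis neg_0_le_iff_le nprt_le_zero zero_le_pprt)
    then show ?thesis
      unfolding G_def by (simp add: algebra_simps)
  qed
  have split: "\<exists>a b. 0 \<le> a \<and> 0 \<le> b \<and> x = a - b" for x :: 'a
    by (rule exI[of _ "pprt x"], rule exI[of _ "- nprt x"]) (simp flip: prts)
  have "linear G"
  proof (rule linearI)
    fix x y :: 'a
    obtain a b c d where x: "0 \<le> a" "0 \<le> b" "x = a - b" and y: "0 \<le> c" "0 \<le> d" "y = c - d"
      using split[of x] split[of y] by blast
    have "G (x + y) = G ((a + c) - (b + d))"
      by (simp add: x(3) y(3) algebra_simps)
    also have "\<dots> = g (a + c) - g (b + d)"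
      using x y by (intro G_diff) auto
    also have "\<dots> = G x + G y"
      using x y by (simp add: G_diff add)
    finally show "G (x + y) = G x + G y" .
  next
    fix r :: real and x :: 'a
    obtain a b where x: "0 \<le> a" "0 \<le> b" "x = a - b"
      using split[of x] by blast
    consider "r = 0" | "r > 0" | "r < 0" by linarith
    then show "G (r *\<^sub>R x) = r *\<^sub>R G x"
    proof cases
      case 1
      then show ?thesis using G_diff[of 0 0] by simp
    next
      case 2
      then have "G (r *\<^sub>R a - r *\<^sub>R b) = r *\<^sub>R g a - r *\<^sub>R g b"
        using x by (subst G_diff) (auto simp: scale scaleR_nonneg_nonneg)
      then show ?thesis
        using x by (simp add: G_diff scaleR_diff_right)
    next
      case 3
      then have "G ((- r) *\<^sub>R b - (- r) *\<^sub>R a) = (- r) *\<^sub>R g b - (- r) *\<^sub>R g a"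
        using x scale[of "- r"]
        by (subst G_diff) (auto simp: scaleR_nonneg_nonneg scaleR_nonpos_nonneg)
      then show ?thesis
        using x by (simp add: G_diff scaleR_diff_right)
    qed
  qed
  moreover have "G x = g x" if "0 \<le> x" for x
    using G_diff[of x 0] that g0 by simp
  ultimately show ?thesis using that by blast
qed

text \<open>Here \<open>super\<close> makes the supremum superadditive, \<open>sub\<close> makes it
  subadditive, and \<open>scale\<close> makes it positively homogeneous, so it is a cone map. This
  is used twice: for the projection onto a band and for the supremum of a net of operators.\<close>

lemma linear_extension_of_Sup:
  fixes A :: "'a::{banach_lattice, conditionally_complete_lattice} \<Rightarrow> 'a set"
  assumes ne: "\<And>x. 0 \<le> x \<Longrightarrow> A x \<noteq> {}"
    and bdd: "\<And>x. 0 \<le> x \<Longrightarrow> bdd_above (A x)"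
    and super: "\<And>x y a b. \<lbrakk>0 \<le> x; 0 \<le> y; a \<in> A x; b \<in> A y\<rbrakk> \<Longrightarrow> \<exists>d\<in>A (x + y). a + b \<le> d"
    and sub: "\<And>x y d. \<lbrakk>0 \<le> x; 0 \<le> y; d \<in> A (x + y)\<rbrakk> \<Longrightarrow> \<exists>a\<in>A x. \<exists>b\<in>A y. d \<le> a + b"
    and scale: "\<And>c x a. \<lbrakk>0 < c; 0 \<le> x; a \<in> A x\<rbrakk> \<Longrightarrow> c *\<^sub>R a \<in> A (c *\<^sub>R x)"
  obtains G where "linear G" "\<And>x. 0 \<le> x \<Longrightarrow> G x = Sup (A x)"
proof (rule linear_extension_of_cone_map[of "\<lambda>x. Sup (A x)"])
  fix x y :: 'a assume x: "0 \<le> x" and y: "0 \<le> y"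
  then have xy: "0 \<le> x + y" by simp
  show "Sup (A (x + y)) = Sup (A x) + Sup (A y)"
  proof (rule antisym)
    show "Sup (A (x + y)) \<le> Sup (A x) + Sup (A y)"
    proof (rule cSup_least[OF ne[OF xy]])
      fix d assume "d \<in> A (x + y)"
      then obtain a b where "a \<in> A x" "b \<in> A y" "d \<le> a + b"
        using sub x y by blast
      then show "d \<le> Sup (A x) + Sup (A y)"
        using bdd x y by (meson add_mono cSup_upper order_trans)
    qed
    \<comment> \<open>The two suprema are taken one at a time: first over \<open>b\<close> with
      \<open>a\<close> fixed, then over \<open>a\<close>.\<close>
    have "a + b \<le> Sup (A (x + y))" if ab: "a \<in> A x" "b \<in> A y" for a b
      using super[OF x y ab] bdd[OF xy] by (meson cSup_upper order_trans)
    then have "b \<le> Sup (A (x + y)) - a" if "a \<in> A x" "b \<in> A y" for a b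
      using that by (simp add: algebra_simps)
    then have "Sup (A y) \<le> Sup (A (x + y)) - a" if "a \<in> A x" for a
      using that ne[OF y] by (intro cSup_least) auto
    then have "a \<le> Sup (A (x + y)) - Sup (A y)" if "a \<in> A x" for a
      using that by (simp add: algebra_simps)
    then have "Sup (A x) \<le> Sup (A (x + y)) - Sup (A y)"
      using ne[OF x] by (intro cSup_least) auto
    then show "Sup (A x) + Sup (A y) \<le> Sup (A (x + y))"
      by (simp add: algebra_simps)
  qed
next
  have le: "c *\<^sub>R Sup (A x) \<le> Sup (A (c *\<^sub>R x))" if c: "0 < c" and x: "0 \<le> x" for c and x :: 'a
  proof -
    have cx: "0 \<le> c *\<^sub>R x"
      using c x by (simp add: scaleR_nonneg_nonneg)
    have "a \<le> inverse c *\<^sub>R Sup (A (c *\<^sub>R x))" if "a \<in> A x" for a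
    proof -
      have "c *\<^sub>R a \<le> Sup (A (c *\<^sub>R x))"
        using scale[OF c x that] bdd[OF cx] by (rule cSup_upper)
      then have "inverse c *\<^sub>R c *\<^sub>R a \<le> inverse c *\<^sub>R Sup (A (c *\<^sub>R x))"
        using c by (intro scaleR_left_mono) auto
      then show ?thesis using c by simp
    qed
    then have "Sup (A x) \<le> inverse c *\<^sub>R Sup (A (c *\<^sub>R x))"
      using ne[OF x] by (intro cSup_least) auto
    then have "c *\<^sub>R Sup (A x) \<le> c *\<^sub>R inverse c *\<^sub>R Sup (A (c *\<^sub>R x))"
      using c by (intro scaleR_left_mono) auto
    then show ?thesis using c by simp
  qed
  fix c :: real and x :: 'a assume c: "0 < c" and x: "0 \<le> x"
  \<comment> \<open>The converse inequality is \<open>le\<close> for the factor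
    \<open>inverse c\<close> at the point \<open>c *\<^sub>R x\<close>.\<close>
  have "inverse c *\<^sub>R Sup (A (c *\<^sub>R x)) \<le> Sup (A (inverse c *\<^sub>R c *\<^sub>R x))"
    using c x by (intro le) (auto simp: scaleR_nonneg_nonneg)
  then have "c *\<^sub>R inverse c *\<^sub>R Sup (A (c *\<^sub>R x)) \<le> c *\<^sub>R Sup (A x)"
    using c by (intro scaleR_left_mono) auto
  then have "Sup (A (c *\<^sub>R x)) \<le> c *\<^sub>R Sup (A x)"
    using c by simp
  then show "Sup (A (c *\<^sub>R x)) = c *\<^sub>R Sup (A x)"
    using le[OF c x] by (rule antisym)
qed (use that in blast)

section \<open>Positive operators and monotonicity of the norm\<close>

lemma abs_positive_linear_le:
  fixes G :: "'a::banach_lattice \<Rightarrow> 'a"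
  assumes "linear G" and "\<And>x. 0 \<le> x \<Longrightarrow> 0 \<le> G x"
  shows "\<bar>G x\<bar> \<le> G \<bar>x\<bar>"
proof (rule abs_leI)
  have "0 \<le> G (\<bar>x\<bar> - x)"
    by (rule assms(2)) (simp add: abs_ge_self)
  then show "G x \<le> G \<bar>x\<bar>"
    using assms(1) by (simp add: linear_diff)
  have "0 \<le> G (\<bar>x\<bar> - (- x))"
    by (rule assms(2)) (simp only: diff_ge_0_iff_ge abs_ge_minus_self)
  then show "- G x \<le> G \<bar>x\<bar>"
    using assms(1) by (simp only: linear_diff linear_neg diff_ge_0_iff_ge)
qed

lemma norm_abs_eq: "norm \<bar>x::'a::banach_lattice\<bar> = norm x"
  by (intro antisym norm_mono_abs) simp_all

lemma norm_mono_nonneg: "0 \<le> x \<Longrightarrow> x \<le> y \<Longrightarrow> norm (x::'a::banach_lattice) \<le> norm y"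
  by (rule norm_mono_abs) (metis abs_of_nonneg order_trans)

text \<open>Both \<open>G\<close> and the order on the cone control absolute values:
  \<open>\<bar>G x\<bar> \<le> G \<bar>x\<bar> \<le> T \<bar>x\<bar>\<close>. With the identity for
  \<open>T\<close> this shows that band projections are contractions; with \<open>T = G\<close> it
  reduces norm bounds to nonnegative vectors.\<close>

lemma norm_dominated_linear_le:
  fixes G T :: "'a::banach_lattice \<Rightarrow> 'a"
  assumes "linear G" and "\<And>x. 0 \<le> x \<Longrightarrow> 0 \<le> G x" and "\<And>x. 0 \<le> x \<Longrightarrow> G x \<le> T x"
  shows "norm (G x) \<le> norm (T \<bar>x\<bar>)"
proof -
  have "\<bar>G x\<bar> \<le> G \<bar>x\<bar>" using abs_positive_linear_le assms by blast
  also have "\<dots> \<le> T \<bar>x\<bar>" using assms by simp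
  finally have "norm \<bar>G x\<bar> \<le> norm (T \<bar>x\<bar>)" by (intro norm_mono_nonneg) auto
  then show ?thesis by (simp add: norm_abs_eq)
qed

lemma blinfun_of_dominated_linear:
  fixes G :: "'a::banach_lattice \<Rightarrow> 'a" and T :: "'a \<Rightarrow>\<^sub>L 'a"
  assumes "linear G" and "\<And>x. 0 \<le> x \<Longrightarrow> 0 \<le> G x" and "\<And>x. 0 \<le> x \<Longrightarrow> G x \<le> T x"
  obtains B :: "'a \<Rightarrow>\<^sub>L 'a" where "blinfun_apply B = G"
proof -
  have "norm (G x) \<le> norm x * norm T" for x
    using norm_dominated_linear_le[of G T x] assms norm_blinfun[of T "\<bar>x\<bar>"]
    by (simp add: norm_abs_eq mult.commute)
  then have "bounded_linear G"
    using assms(1) by (intro bounded_linear_intro[of G "norm T"])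
      (auto simp: linear_add linear_scale)
  then show ?thesis using that bounded_linear_Blinfun_apply by blast
qed

lemma linear_blinfun: "linear (blinfun_apply B)"
  using blinfun.bounded_linear_right bounded_linear.linear by blast

subsection \<open>Band projections\<close>

text \<open>The idempotents between 0 and the identity are exactly the projections onto projection
  bands. In this form the complement \<open>id_blinfun - P\<close> is visibly of the same
  kind.\<close>

definition band_projection :: "('a::banach_lattice \<Rightarrow>\<^sub>L 'a) \<Rightarrow> bool" where
  "band_projection P \<longleftrightarrow> (\<forall>x. P (P x) = P x) \<and> (\<forall>x\<ge>0. 0 \<le> P x \<and> P x \<le> x)"

lemma band_projection_idem: "band_projection P \<Longrightarrow> P (P x) = P x"
  and band_projection_nonneg: "band_projection P \<Longrightarrow> 0 \<le> x \<Longrightarrow> 0 \<le> P x"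
  and band_projection_le: "band_projection P \<Longrightarrow> 0 \<le> x \<Longrightarrow> P x \<le> x"
  by (auto simp: band_projection_def)

lemma band_projection_compl: "band_projection P \<Longrightarrow> band_projection (id_blinfun - P)"
  by (auto simp: band_projection_def blinfun.diff_left blinfun.diff_right)

lemma band_projection_norm_le: "band_projection P \<Longrightarrow> norm (P x) \<le> norm x"
  using norm_dominated_linear_le[of P "\<lambda>x. x" x]
  by (simp add: linear_blinfun band_projection_nonneg band_projection_le norm_abs_eq)

text \<open>The complement of \<open>P\<close> is positive and kills \<open>P x\<close>; applied to
  \<open>P x - z \<ge> 0\<close> it gives \<open>z \<le> P z\<close>.\<close>

lemma band_projection_eq_of_le:
  assumes P: "band_projection P" and "0 \<le> z" "z \<le> P x"
  shows "P z = z"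
proof -
  have "0 \<le> (id_blinfun - P) (P x - z)"
    using assms band_projection_nonneg[OF band_projection_compl[OF P], of "P x - z"] by simp
  then have "z \<le> P z"
    using P by (simp add: blinfun.diff_left blinfun.diff_right band_projection_idem)
  then show ?thesis
    using band_projection_le[OF P assms(2)] by (rule antisym[rotated])
qed

text \<open>The infimum lies below an element of each range, so both \<open>P\<close> and its
  complement fix it; their sum is the identity, which forces it to be 0.\<close>

lemma band_projection_disjoint:
  assumes P: "band_projection P" and "0 \<le> x" "0 \<le> y"
  shows "inf (P x) ((id_blinfun - P) y) = 0"
proof -
  let ?z = "inf (P x) ((id_blinfun - P) y)"
  have z: "0 \<le> ?z"
    using assms band_projection_compl by (auto intro!: band_projection_nonneg)
  have "P ?z = ?z"
    using P z by (rule band_projection_eq_of_le) (rule inf_le1)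
  moreover have "(id_blinfun - P) ?z = ?z"
    using band_projection_compl[OF P] z by (rule band_projection_eq_of_le) (rule inf_le2)
  ultimately show ?thesis by (simp add: blinfun.diff_left)
qed

text \<open>Since \<open>0 \<le> Q (P x) \<le> P x\<close> on the cone, \<open>Q\<close> leaves the
  range of \<open>P\<close> invariant, and likewise the range of the complement. The first fact says
  \<open>P Q P = Q P\<close>, the second \<open>P Q P = P Q\<close>.\<close>

lemma band_projection_commute:
  assumes P: "band_projection P" and Q: "band_projection Q"
  shows "P (Q x) = Q (P x)"
proof -
  have pos: "P (Q x) = Q (P x)" if x: "0 \<le> x" for x
  proof -
    let ?P' = "id_blinfun - P"
    note P' = band_projection_compl[OF P]
    have 1: "P (Q (P x)) = Q (P x)"
      using P Q x by (intro band_projection_eq_of_le[OF P, of _ x])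
        (auto intro!: band_projection_nonneg band_projection_le)
    have "?P' (Q (?P' x)) = Q (?P' x)"
      using P' Q x by (intro band_projection_eq_of_le[OF P', of _ x])
        (auto intro!: band_projection_nonneg band_projection_le)
    with 1 show ?thesis
      by (simp add: blinfun.diff_left blinfun.diff_right)
  qed
  have "P (Q (pprt x + nprt x)) = Q (P (pprt x + nprt x))"
    using pos[of "pprt x"] pos[of "- nprt x"]
    by (simp add: blinfun.add_right blinfun.minus_right)
  then show ?thesis by (simp flip: prts)
qed

text \<open>On the cone, \<open>P x\<close> is the supremum of the elements of \<open>Y\<close>
  between 0 and \<open>x\<close>. Dedekind completeness provides it, and closure of the band under
  suprema puts it in \<open>Y\<close>.\<close>

lemma band_projection_exists:
  fixes Y :: "'a::{banach_lattice, conditionally_complete_lattice} set"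
  assumes "band Y"
  obtains P :: "'a \<Rightarrow>\<^sub>L 'a"
  where "band_projection P" "\<And>x. P x \<in> Y" "\<And>x. x \<in> Y \<Longrightarrow> 0 \<le> x \<Longrightarrow> P x = x"
proof -
  have sub: "subspace Y" and ideal: "\<And>x y. y \<in> Y \<Longrightarrow> \<bar>x\<bar> \<le> \<bar>y\<bar> \<Longrightarrow> x \<in> Y"
    and lub: "\<And>A s. A \<subseteq> Y \<Longrightarrow> isLub UNIV A s \<Longrightarrow> s \<in> Y"
    using assms unfolding band_def order_ideal_def by blast+
  define A where "A x = {y \<in> Y. 0 \<le> y \<and> y \<le> x}" for x
  have ne: "A x \<noteq> {}" if "0 \<le> x" for x
    using that subspace_0[OF sub] unfolding A_def by blast
  have bdd: "bdd_above (A x)" for x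
    unfolding A_def by (rule bdd_aboveI[of _ x]) simp
  obtain G where G: "linear G" "\<And>x. 0 \<le> x \<Longrightarrow> G x = Sup (A x)"
  proof (rule linear_extension_of_Sup[of A])
    fix x y a b :: 'a assume "a \<in> A x" "b \<in> A y"
    then have "a + b \<in> A (x + y)"
      using sub by (auto simp: A_def subspace_add add_mono)
    then show "\<exists>d\<in>A (x + y). a + b \<le> d" by blast
  next
    fix x y d :: 'a assume x: "0 \<le> x" and y: "0 \<le> y" and d: "d \<in> A (x + y)"
    \<comment> \<open>Riesz decomposition: as \<open>d - y\<close> lies below both \<open>d\<close>
      and \<open>x\<close>, it lies below \<open>inf d x\<close>, so the remainder
      \<open>d - a\<close> is at most \<open>y\<close>.\<close>
    define a where "a = inf d x"
    have a: "0 \<le> a" "a \<le> d" "a \<le> x"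
      using x d by (auto simp: a_def A_def)
    have "d - y \<le> a"
      using d y unfolding a_def A_def by (auto simp: algebra_simps)
    then have "d - a \<le> y" by (simp add: algebra_simps)
    moreover have "a \<in> Y"
    proof (rule ideal)
      show "d \<in> Y" using d by (simp add: A_def)
      have "0 \<le> d" using d by (simp add: A_def)
      then show "\<bar>a\<bar> \<le> \<bar>d\<bar>"
        unfolding abs_of_nonneg[OF a(1)] abs_of_nonneg[OF \<open>0 \<le> d\<close>] by (intro a(2))
    qed
    ultimately have "a \<in> A x" "d - a \<in> A y"
      using a d sub by (auto simp: A_def subspace_diff)
    then show "\<exists>a\<in>A x. \<exists>b\<in>A y. d \<le> a + b"
      by (intro bexI[of _ a] bexI[of _ "d - a"]) auto
  next
    fix c :: real and x a :: 'a assume "0 < c" "a \<in> A x"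
    then show "c *\<^sub>R a \<in> A (c *\<^sub>R x)"
      using sub by (auto simp: A_def subspace_scale scaleR_nonneg_nonneg scaleR_left_mono)
  qed (use ne bdd in auto)
  have G_nonneg: "0 \<le> G x" if "0 \<le> x" for x
    unfolding G(2)[OF that] using that bdd[of x] subspace_0[OF sub]
    by (intro cSup_upper) (auto simp: A_def)
  have G_le: "G x \<le> x" if "0 \<le> x" for x
    unfolding G(2)[OF that] using ne[OF that] by (intro cSup_least) (auto simp: A_def)
  have G_mem: "G x \<in> Y" if "0 \<le> x" for x
  proof (rule lub[of "A x"])
    show "isLub UNIV (A x) (G x)"
      unfolding G(2)[OF that] isLub_def leastP_def isUb_def setle_def setge_def
      using ne[OF that] bdd[of x] by (auto intro: cSup_upper cSup_least)
  qed (auto simp: A_def)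
  have G_fix: "G x = x" if "x \<in> Y" "0 \<le> x" for x
    using that bdd[of x] G_le[of x] unfolding G(2)[OF that(2)]
    by (intro antisym cSup_upper) (auto simp: A_def)
  have mem: "G x \<in> Y" for x
  proof (rule ideal[of "G \<bar>x\<bar>"])
    show "\<bar>G x\<bar> \<le> \<bar>G \<bar>x\<bar>\<bar>"
      using abs_positive_linear_le[OF G(1) G_nonneg, of x] by (meson abs_ge_self order_trans)
  qed (simp add: G_mem)
  have idem: "G (G x) = G x" for x
  proof -
    have "G x = G (pprt x) - G (- nprt x)"
      using linear_diff[OF G(1), of "pprt x" "- nprt x"] by (simp flip: prts)
    then show ?thesis
      using linear_diff[OF G(1), of "G (pprt x)" "G (- nprt x)"]
      by (simp add: G_fix G_mem G_nonneg)
  qed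
  obtain P :: "'a \<Rightarrow>\<^sub>L 'a" where P: "blinfun_apply P = G"
    using blinfun_of_dominated_linear[of G id_blinfun] G(1) G_nonneg G_le by auto
  show ?thesis
    by (rule that[of P]) (auto simp: P band_projection_def idem G_nonneg G_le mem G_fix)
qed

text \<open>The test vector is \<open>y = (1 - P) \<bar>T (P x)\<bar>\<close>. It is disjoint from
  \<open>P x\<close> and lies below \<open>\<bar>T (P x)\<bar>\<close>, so the infimum in the
  definition is \<open>y\<close> itself. The other corner comes from replacing \<open>P\<close> by
  its complement.\<close>

lemma eps_band_preserving_off_diagonal:
  fixes T :: "'a::banach_lattice \<Rightarrow>\<^sub>L 'a"
  assumes T: "eps_band_preserving \<epsilon> T" and "0 \<le> \<epsilon>" and P: "band_projection P"
  shows "norm ((id_blinfun - P) (T (P x))) \<le> \<epsilon> * norm x"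
proof -
  let ?P' = "id_blinfun - P" and ?z = "P x"
  let ?y = "?P' \<bar>T ?z\<bar>" and ?D = "{y. 0 \<le> y \<and> lattice_disjoint y ?z}"
  note P' = band_projection_compl[OF P]
  have y: "0 \<le> ?y" "?y \<le> \<bar>T ?z\<bar>"
    using P' by (auto intro: band_projection_nonneg band_projection_le)
  have "\<bar>?z\<bar> \<le> P \<bar>x\<bar>"
    using P by (intro abs_positive_linear_le) (auto simp: linear_blinfun band_projection_nonneg)
  then have "inf ?y \<bar>?z\<bar> \<le> inf (P \<bar>x\<bar>) ?y"
    by (simp add: le_infI2)
  also have "\<dots> = 0"
    using P by (intro band_projection_disjoint) auto
  finally have "lattice_disjoint ?y ?z"
    unfolding lattice_disjoint_def using y by (intro antisym) (auto simp: abs_of_nonneg)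
  then have "?y \<in> ?D" using y by simp
  moreover have "bdd_above ((\<lambda>y. norm (inf \<bar>T ?z\<bar> y)) ` ?D)"
  proof (rule bdd_aboveI2[of _ _ "norm (T ?z)"])
    fix y assume "y \<in> ?D"
    then have "norm (inf \<bar>T ?z\<bar> y) \<le> norm \<bar>T ?z\<bar>"
      by (intro norm_mono_nonneg) auto
    then show "norm (inf \<bar>T ?z\<bar> y) \<le> norm (T ?z)" by (simp add: norm_abs_eq)
  qed
  ultimately have "norm (inf \<bar>T ?z\<bar> ?y) \<le> (SUP y\<in>?D. norm (inf \<bar>T ?z\<bar> y))"
    by (rule cSUP_upper)
  also have "\<dots> \<le> \<epsilon> * norm ?z"
    using T unfolding eps_band_preserving_def by blast
  also have "\<dots> \<le> \<epsilon> * norm x"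
    using assms(2) band_projection_norm_le[OF P] by (rule mult_left_mono[rotated])
  finally have "norm ?y \<le> \<epsilon> * norm x"
    using y by (simp add: inf_absorb2)
  moreover have "norm (?P' (T ?z)) \<le> norm ?y"
    using P' by (intro norm_dominated_linear_le) (auto simp: linear_blinfun band_projection_nonneg)
  ultimately show ?thesis by simp
qed

subsection \<open>Compressions\<close>

text \<open>For a band projection this is \<open>P - (1 - P)\<close>, an involution: 1 on the band
  and -1 on its disjoint complement.\<close>

definition reflection :: "('a::banach_lattice \<Rightarrow>\<^sub>L 'a) \<Rightarrow> ('a \<Rightarrow>\<^sub>L 'a)" where
  "reflection P = 2 *\<^sub>R P - id_blinfun"

definition conj_reflection :: "('a::banach_lattice \<Rightarrow>\<^sub>L 'a) \<Rightarrow> ('a \<Rightarrow>\<^sub>L 'a) \<Rightarrow> ('a \<Rightarrow>\<^sub>L 'a)" where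
  "conj_reflection P T = reflection P o\<^sub>L (T o\<^sub>L reflection P)"

text \<open>The block diagonal part of \<open>T\<close> for the splitting of the space by
  \<open>P\<close>.\<close>

definition compression :: "('a::banach_lattice \<Rightarrow>\<^sub>L 'a) \<Rightarrow> ('a \<Rightarrow>\<^sub>L 'a) \<Rightarrow> ('a \<Rightarrow>\<^sub>L 'a)" where
  "compression P T = (P o\<^sub>L (T o\<^sub>L P)) + ((id_blinfun - P) o\<^sub>L (T o\<^sub>L (id_blinfun - P)))"

fun compressions :: "('a::banach_lattice \<Rightarrow>\<^sub>L 'a) list \<Rightarrow> ('a \<Rightarrow>\<^sub>L 'a) \<Rightarrow> ('a \<Rightarrow>\<^sub>L 'a)" where
  "compressions [] T = T"
| "compressions (P # Ps) T = compressions Ps (compression P T)"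

lemmas blinfun_linear_simps =
  blinfun.add_left blinfun.add_right blinfun.diff_left blinfun.diff_right
  blinfun.scaleR_left blinfun.scaleR_right blinfun.minus_left blinfun.minus_right

text \<open>Reflections form a commutative group: \<open>(2 P - 1) (2 Q - 1) = 2 R - 1\<close> with
  \<open>R = P Q + (1 - P) (1 - Q)\<close>.\<close>

lemma conj_reflection_comp:
  assumes P: "band_projection P" and Q: "band_projection Q"
  obtains R where "band_projection R"
    "\<And>T. conj_reflection P (conj_reflection Q T) = conj_reflection R T"
proof
  let ?P' = "id_blinfun - P" and ?Q' = "id_blinfun - Q"
  let ?R = "(P o\<^sub>L Q) + (?P' o\<^sub>L ?Q')"
  note P' = band_projection_compl[OF P] and Q' = band_projection_compl[OF Q]
  note simps = blinfun_linear_simps band_projection_commute[OF P Q]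
    band_projection_idem[OF P] band_projection_idem[OF Q]
  show "band_projection ?R"
    unfolding band_projection_def
  proof (intro conjI allI impI)
    fix x show "?R (?R x) = ?R x"
      by (simp add: simps)
  next
    fix x :: 'a assume x: "0 \<le> x"
    show "0 \<le> ?R x"
      unfolding blinfun.add_left blinfun_apply_blinfun_compose
      using P Q P' Q' x by (intro add_nonneg_nonneg) (auto intro!: band_projection_nonneg)
    \<comment> \<open>The two mixed products are what \<open>?R\<close> lacks from the
      identity.\<close>
    have "0 \<le> P (?Q' x) + ?P' (Q x)"
      using P Q P' Q' x by (intro add_nonneg_nonneg) (auto intro!: band_projection_nonneg)
    also have "\<dots> = x - ?R x"
      by (simp add: simps)
    finally show "?R x \<le> x" by simp
  qed
  fix T
  \<comment> \<open>Both factorisations are needed: the reflections left of \<open>T\<close> occur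
    in the order \<open>P\<close>, \<open>Q\<close>, those right of it in the order
    \<open>Q\<close>, \<open>P\<close>.\<close>
  have R: "reflection ?R x = reflection P (reflection Q x)"
    "reflection ?R x = reflection Q (reflection P x)" for x
    by (simp_all add: reflection_def simps algebra_simps scaleR_2)
  show "conj_reflection P (conj_reflection Q T) = conj_reflection ?R T"
    by (rule blinfun_eqI) (simp add: conj_reflection_def R(1)[of "T _"] R(2)[symmetric])
qed

lemma compression_eq_average:
  "compression P T = (1/2) *\<^sub>R (T + conj_reflection P T)"
proof -
  have "2 *\<^sub>R compression P T = T + conj_reflection P T"
    by (rule blinfun_eqI)
      (simp add: compression_def conj_reflection_def reflection_def blinfun_linear_simps
        scaleR_2 algebra_simps)
  then have "(1/2) *\<^sub>R 2 *\<^sub>R compression P T = (1/2) *\<^sub>R (T + conj_reflection P T)"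
    by simp
  then show ?thesis by simp
qed

lemma compression_linear:
  "compression P (c *\<^sub>R (A + B)) = c *\<^sub>R (compression P A + compression P B)"
  by (rule blinfun_eqI) (simp add: compression_def blinfun_linear_simps algebra_simps)

lemma compressions_linear:
  "compressions Ps (c *\<^sub>R (A + B)) = c *\<^sub>R (compressions Ps A + compressions Ps B)"
  by (induction Ps arbitrary: A B) (simp_all add: compression_linear)

lemma compressions_append: "compressions (Ps @ Qs) T = compressions Qs (compressions Ps T)"
  by (induction Ps arbitrary: T) simp_all

lemma compression_mono:
  assumes P: "band_projection P" and "operator_le (blinfun_apply A) (blinfun_apply B)"
  shows "operator_le (compression P A) (compression P B)"
  unfolding operator_le_def
proof (intro allI impI)
  fix x :: 'a assume x: "0 \<le> x"
  note P' = band_projection_compl[OF P]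
  have AB: "0 \<le> (B - A) y" if "0 \<le> y" for y
    using assms(2) that by (simp add: operator_le_def blinfun.diff_left)
  have "0 \<le> P ((B - A) (P x)) + (id_blinfun - P) ((B - A) ((id_blinfun - P) x))"
    using P P' x
    by (intro add_nonneg_nonneg band_projection_nonneg[OF P] band_projection_nonneg[OF P'] AB)
  then have "0 \<le> compression P B x - compression P A x"
    by (simp add: compression_def blinfun_linear_simps algebra_simps)
  then show "compression P A x \<le> compression P B x" by simp
qed

text \<open>What a compression removes are the two corners \<open>P A (1 - P)\<close> and
  \<open>(1 - P) A P\<close>, which are positive.\<close>

lemma compression_le:
  assumes P: "band_projection P" and "operator_le (\<lambda>_. 0) (blinfun_apply A)"
  shows "operator_le (compression P A) A"
  unfolding operator_le_def
proof (intro allI impI)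
  fix x :: 'a assume x: "0 \<le> x"
  note P' = band_projection_compl[OF P]
  have A: "0 \<le> A y" if "0 \<le> y" for y
    using assms(2) that by (simp add: operator_le_def)
  have "0 \<le> P (A ((id_blinfun - P) x)) + (id_blinfun - P) (A (P x))"
    using P P' x
    by (intro add_nonneg_nonneg band_projection_nonneg[OF P] band_projection_nonneg[OF P'] A)
  then have "0 \<le> A x - compression P A x"
    by (simp add: compression_def blinfun_linear_simps algebra_simps)
  then show "compression P A x \<le> A x" by simp
qed

lemma operator_le_trans: "operator_le A B \<Longrightarrow> operator_le B C \<Longrightarrow> operator_le A C"
  unfolding operator_le_def by (meson order_trans)

lemma compressions_mono:
  "\<forall>P\<in>set Ps. band_projection P \<Longrightarrow> operator_le (blinfun_apply A) (blinfun_apply B) \<Longrightarrow>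
    operator_le (compressions Ps A) (compressions Ps B)"
  by (induction Ps arbitrary: A B) (simp_all add: compression_mono)

lemma compression_nonneg:
  assumes "band_projection P" "operator_le (\<lambda>_. 0) (blinfun_apply A)"
  shows "operator_le (\<lambda>_. 0) (blinfun_apply (compression P A))"
  using compression_mono[of P 0 A] assms
  by (simp add: compression_def operator_le_def blinfun.add_left)

lemma compressions_nonneg:
  "\<forall>P\<in>set Ps. band_projection P \<Longrightarrow> operator_le (\<lambda>_. 0) (blinfun_apply A) \<Longrightarrow>
    operator_le (\<lambda>_. 0) (blinfun_apply (compressions Ps A))"
  by (induction Ps arbitrary: A) (simp_all add: compression_nonneg)

lemma compressions_le:
  "\<forall>P\<in>set Ps. band_projection P \<Longrightarrow> operator_le (\<lambda>_. 0) (blinfun_apply A) \<Longrightarrow>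
    operator_le (compressions Ps A) A"
proof (induction Ps arbitrary: A)
  case Nil
  then show ?case by (simp add: operator_le_def)
next
  case (Cons P Ps)
  then show ?case
    using operator_le_trans[OF Cons.IH[of "compression P A"] compression_le[of P A]]
    by (simp add: compression_nonneg)
qed

lemma norm_diff_conj_reflection_le:
  fixes T :: "'a::banach_lattice \<Rightarrow>\<^sub>L 'a"
  assumes T: "eps_band_preserving \<epsilon> T" and \<epsilon>: "0 \<le> \<epsilon>" and P: "band_projection P"
  shows "norm (T - conj_reflection P T) \<le> 4 * \<epsilon>"
proof (rule norm_blinfun_bound)
  fix x
  let ?P' = "id_blinfun - P"
  let ?a = "?P' (T (P x))" and ?b = "P (T (?P' x))"
  have a: "norm ?a \<le> \<epsilon> * norm x"
    using eps_band_preserving_off_diagonal[OF T \<epsilon> P] .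
  have b: "norm ?b \<le> \<epsilon> * norm x"
    using eps_band_preserving_off_diagonal[OF T \<epsilon> band_projection_compl[OF P], of x] by simp
  have "(T - conj_reflection P T) x = 2 *\<^sub>R (?a + ?b)"
    by (simp add: conj_reflection_def reflection_def blinfun_linear_simps scaleR_2 algebra_simps)
  then have "norm ((T - conj_reflection P T) x) = 2 * norm (?a + ?b)"
    by simp
  also have "\<dots> \<le> 2 * (norm ?a + norm ?b)"
    by (intro mult_left_mono norm_triangle_ineq) simp
  finally show "norm ((T - conj_reflection P T) x) \<le> 4 * \<epsilon> * norm x"
    using a b by simp
qed (use \<epsilon> in simp)

lemma norm_diff_average_le:
  fixes A B C :: "'a::real_normed_vector"
  assumes "norm (A - B) \<le> d" "norm (A - C) \<le> d"
  shows "norm (A - (1/2) *\<^sub>R (B + C)) \<le> d"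
proof -
  have "(1/2) *\<^sub>R A + (1/2) *\<^sub>R A = A"
    by (simp flip: scaleR_add_left)
  then have "A - (1/2) *\<^sub>R (B + C) = (1/2) *\<^sub>R (A - B) + (1/2) *\<^sub>R (A - C)"
    by (simp add: algebra_simps)
  then have "norm (A - (1/2) *\<^sub>R (B + C)) \<le> (1/2) * norm (A - B) + (1/2) * norm (A - C)"
    using norm_triangle_ineq[of "(1/2) *\<^sub>R (A - B)" "(1/2) *\<^sub>R (A - C)"] by simp
  then show ?thesis using assms by simp
qed

text \<open>Conjugating \<open>T\<close> by an arbitrary reflection first makes the induction on \<open>Ps\<close> go through.\<close>

lemma norm_diff_compressions_conj_reflection_le:
  assumes T: "eps_band_preserving \<epsilon> (blinfun_apply T)" and \<epsilon>: "0 \<le> \<epsilon>"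
    and "\<forall>P\<in>set Ps. band_projection P" and "band_projection Q"
  shows "norm (T - compressions Ps (conj_reflection Q T)) \<le> 4 * \<epsilon>"
  using assms(3,4)
proof (induction Ps arbitrary: Q)
  case Nil
  then show ?case using norm_diff_conj_reflection_le[OF T \<epsilon>] by simp
next
  case (Cons P Ps)
  then have "band_projection P" by simp
  \<comment> \<open>Compressing by \<open>P\<close> averages the conjugates of \<open>T\<close> by
    \<open>Q\<close> and by \<open>R\<close>, so the induction hypothesis is used for both.\<close>
  with Cons.prems(2) obtain R where R: "band_projection R"
    "conj_reflection P (conj_reflection Q T) = conj_reflection R T"
    using conj_reflection_comp by metis
  then show ?case
    using Cons.prems Cons.IH[of Q] Cons.IH[of R]
    by (simp add: compression_eq_average compressions_linear norm_diff_average_le)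
qed

lemma norm_diff_compressions_le:
  assumes "eps_band_preserving \<epsilon> (blinfun_apply T)" and "0 \<le> \<epsilon>"
    and "\<forall>P\<in>set Ps. band_projection P"
  shows "norm (T - compressions Ps T) \<le> 4 * \<epsilon>"
proof -
  \<comment> \<open>The reflection of the identity is the identity, so this choice of
    \<open>Q\<close> leaves \<open>T\<close> unchanged.\<close>
  have "band_projection (id_blinfun :: 'a \<Rightarrow>\<^sub>L 'a)"
    by (simp add: band_projection_def)
  moreover have "conj_reflection id_blinfun T = T"
    by (rule blinfun_eqI) (simp add: conj_reflection_def reflection_def blinfun_linear_simps scaleR_2)
  ultimately show ?thesis
    using norm_diff_compressions_conj_reflection_le[OF assms, of id_blinfun] by simp
qed

section \<open>The infimum of the net of compressions\<close>

theorem proposition5p2: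
  fixes T :: "'a::{banach_lattice, conditionally_complete_lattice} \<Rightarrow>\<^sub>L 'a"
    and f \<epsilon> :: real
  assumes "fatou_norm TYPE('a) f"
    and "0 \<le> \<epsilon>"
    and "operator_le (\<lambda>_. 0) (blinfun_apply T)"
    and "eps_band_preserving \<epsilon> (blinfun_apply T)"
  shows "\<exists>S :: 'a \<Rightarrow>\<^sub>L 'a.
           operator_le (\<lambda>_. 0) (blinfun_apply S) \<and>
           operator_le (blinfun_apply S) (blinfun_apply T) \<and>
           band_preserving (blinfun_apply S) \<and>
           norm (T - S) \<le> 4 * f * \<epsilon>"
proof -
  define I where "I = {Ps :: ('a \<Rightarrow>\<^sub>L 'a) list. \<forall>P\<in>set Ps. band_projection P}"
  \<comment> \<open>The differences turn the decreasing net of compressions into an increasing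
    nonnegative one, to which suprema and the Fatou property apply.\<close>
  define W where "W Ps = T - compressions Ps T" for Ps
  have W_nonneg: "0 \<le> W Ps x" if "Ps \<in> I" "0 \<le> x" for Ps x
    using compressions_le[of Ps T] assms(3) that
    by (simp add: W_def I_def operator_le_def blinfun.diff_left)
  have W_le: "W Ps x \<le> T x" if "Ps \<in> I" "0 \<le> x" for Ps x
    using compressions_nonneg[of Ps T] assms(3) that
    by (simp add: W_def I_def operator_le_def blinfun.diff_left)
  \<comment> \<open>Concatenation directs the index set. The first bound holds because compressing
    by \<open>Qs\<close> decreases the positive operator \<open>compressions Ps T\<close>, the
    second by monotonicity from \<open>compressions Ps T \<le> T\<close>.\<close>
  have W_append: "W Ps x \<le> W (Ps @ Qs) x" "W Qs x \<le> W (Ps @ Qs) x"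
    if "Ps \<in> I" "Qs \<in> I" "0 \<le> x" for Ps Qs x
    using compressions_le[of Qs "compressions Ps T"] compressions_nonneg[of Ps T]
      compressions_mono[of Qs "compressions Ps T" T] compressions_le[of Ps T] assms(3) that
    by (simp_all add: W_def I_def operator_le_def blinfun.diff_left compressions_append)
  have append_I: "Ps @ Qs \<in> I" if "Ps \<in> I" "Qs \<in> I" for Ps Qs
    using that by (auto simp: I_def)
  have Nil_I: "[] \<in> I" by (simp add: I_def)
  define A where "A x = (\<lambda>Ps. W Ps x) ` I" for x
  have ne: "A x \<noteq> {}" for x
    using Nil_I by (auto simp: A_def)
  have bdd: "bdd_above (A x)" if "0 \<le> x" for x
    unfolding A_def using W_le that by (intro bdd_aboveI2[of _ _ "T x"]) auto
  obtain G where G: "linear G" "\<And>x. 0 \<le> x \<Longrightarrow> G x = Sup (A x)"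
  proof (rule linear_extension_of_Sup[of A])
    fix x y a b :: 'a assume xy: "0 \<le> x" "0 \<le> y" and "a \<in> A x" "b \<in> A y"
    then obtain Ps Qs where "Ps \<in> I" "Qs \<in> I" "a = W Ps x" "b = W Qs y"
      by (auto simp: A_def)
    then have "a + b \<le> W (Ps @ Qs) (x + y)" "W (Ps @ Qs) (x + y) \<in> A (x + y)"
      using W_append[of Ps Qs] append_I[of Ps Qs] xy
      by (auto simp: A_def blinfun.add_right add_mono)
    then show "\<exists>d\<in>A (x + y). a + b \<le> d" by blast
  next
    fix x y d :: 'a assume "d \<in> A (x + y)"
    then show "\<exists>a\<in>A x. \<exists>b\<in>A y. d \<le> a + b"
      by (auto simp: A_def blinfun.add_right)
  next
    fix c :: real and x a :: 'a assume "a \<in> A x"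
    then show "c *\<^sub>R a \<in> A (c *\<^sub>R x)"
      by (auto simp: A_def blinfun.scaleR_right)
  qed (use ne bdd in auto)
  have W_le_G: "W Ps x \<le> G x" if "Ps \<in> I" "0 \<le> x" for Ps x
    unfolding G(2)[OF that(2)] using that bdd by (intro cSup_upper) (auto simp: A_def)
  have G_nonneg: "0 \<le> G x" if "0 \<le> x" for x
    using W_le_G[OF Nil_I that] W_nonneg[OF Nil_I that] by simp
  have G_le: "G x \<le> T x" if "0 \<le> x" for x
    unfolding G(2)[OF that] using ne W_le that by (intro cSup_least) (auto simp: A_def)
  obtain B :: "'a \<Rightarrow>\<^sub>L 'a" where B: "blinfun_apply B = G"
    using blinfun_of_dominated_linear[of G T] G(1) G_nonneg G_le by blast
  have f: "0 \<le> f"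
    using assms(1) by (simp add: fatou_norm_def)
  have G_norm: "norm (G x) \<le> 4 * f * \<epsilon> * norm x" if x: "0 \<le> x" for x
  proof -
    have bound: "norm (W Ps x) \<le> 4 * \<epsilon> * norm x" if "Ps \<in> I" for Ps
      using norm_diff_compressions_le[OF assms(4,2), of Ps] that
      by (intro norm_blinfun[THEN order_trans] mult_right_mono) (auto simp: W_def I_def)
    \<comment> \<open>For fixed \<open>x\<close> the lists are ordered by their values at
      \<open>x\<close>, so only directedness requires an argument.\<close>
    have "increasing_net I (\<lambda>Ps Qs. W Ps x \<le> W Qs x) (\<lambda>Ps. W Ps x)"
      unfolding increasing_net_def directed_index_def
    proof (intro conjI ballI impI)
      fix Ps Qs assume "Ps \<in> I" "Qs \<in> I"
      then show "\<exists>Rs\<in>I. W Ps x \<le> W Rs x \<and> W Qs x \<le> W Rs x"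
        using append_I W_append x by blast
    qed (use Nil_I in auto)
    moreover have "isLub UNIV ((\<lambda>Ps. W Ps x) ` I) (G x)"
      unfolding G(2)[OF x] isLub_def leastP_def isUb_def setle_def setge_def A_def[symmetric]
      using ne bdd[OF x] by (auto intro: cSup_upper cSup_least)
    moreover have "bdd_above ((\<lambda>Ps. norm (W Ps x)) ` I)"
      using bound by (intro bdd_aboveI2) auto
    ultimately have "norm (G x) \<le> f * (SUP Ps\<in>I. norm (W Ps x))"
      using W_nonneg x by (intro fatou_normD[OF assms(1)]) auto
    also have "\<dots> \<le> f * (4 * \<epsilon> * norm x)"
      using Nil_I bound f by (intro mult_left_mono cSUP_least) auto
    finally show ?thesis by (simp add: algebra_simps)
  qed
  \<comment> \<open>\<open>G\<close> dominates itself, which carries the bound from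
    \<open>\<bar>x\<bar>\<close> over to \<open>x\<close>.\<close>
  have "norm (G x) \<le> 4 * f * \<epsilon> * norm x" for x
    using norm_dominated_linear_le[of G G x] G(1) G_nonneg G_norm[of "\<bar>x\<bar>"]
    by (simp add: norm_abs_eq)
  then have norm_B: "norm B \<le> 4 * f * \<epsilon>"
    using f assms(2) by (intro norm_blinfun_bound) (simp_all add: B)
  define S where "S = T - B"
  have S_nonneg: "0 \<le> S x" if "0 \<le> x" for x
    using G_le[OF that] by (simp add: S_def B blinfun.diff_left)
  have "band_preserving S"
    unfolding band_preserving_def
  proof (intro conjI allI impI subsetI)
    fix Y y assume Y: "band Y" and "y \<in> S ` Y"
    then obtain x where x: "x \<in> Y" "y = S x" by blast
    from Y have ideal: "v \<in> Y" if "u \<in> Y" "\<bar>v\<bar> \<le> \<bar>u\<bar>" for u v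
      using that unfolding band_def order_ideal_def by blast
    obtain P :: "'a \<Rightarrow>\<^sub>L 'a" where P: "band_projection P" "\<And>x. P x \<in> Y"
      "\<And>x. x \<in> Y \<Longrightarrow> 0 \<le> x \<Longrightarrow> P x = x"
      using band_projection_exists[OF Y] by blast
    have "\<bar>x\<bar> \<in> Y" using x by (auto intro: ideal[of x])
    then have "P \<bar>x\<bar> = \<bar>x\<bar>" by (simp add: P)
    \<comment> \<open>The complement of \<open>P\<close> kills \<open>\<bar>x\<bar>\<close>, so the
      single compression by \<open>P\<close> sends \<open>\<bar>x\<bar>\<close> to
      \<open>P (T \<bar>x\<bar>)\<close>, an element of \<open>Y\<close>. It dominates
      \<open>S \<bar>x\<bar>\<close>, and the ideal property gives
      \<open>S x \<in> Y\<close>.\<close>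
    moreover have "W [P] \<bar>x\<bar> \<le> G \<bar>x\<bar>"
      using P(1) by (intro W_le_G) (auto simp: I_def)
    ultimately have "S \<bar>x\<bar> \<le> P (T \<bar>x\<bar>)"
      by (simp add: S_def W_def B compression_def blinfun_linear_simps algebra_simps)
    moreover have "\<bar>S x\<bar> \<le> S \<bar>x\<bar>"
      using S_nonneg by (intro abs_positive_linear_le) (auto simp: linear_blinfun)
    ultimately have "\<bar>S x\<bar> \<le> \<bar>P (T \<bar>x\<bar>)\<bar>"
      by (meson abs_ge_self order_trans)
    then show "y \<in> Y"
      using ideal P(2) x by blast
  qed (rule linear_blinfun)
  moreover have "operator_le (\<lambda>_. 0) S" "operator_le S T"
    using S_nonneg G_nonneg by (auto simp: operator_le_def S_def B blinfun.diff_left)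
  moreover have "norm (T - S) \<le> 4 * f * \<epsilon>"
    using norm_B by (simp add: S_def)
  ultimately show ?thesis by blast
qed

end
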